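(* Let $\varepsilon>0$, let $k\ge1$ be an integer, let $c>0$, and let $f$ be an effort function. Suppose every worker is assigned $k$ tasks, the penalty constant of the loss $\ell(x,y)=c(x-y)^2$ is $c$, and the probability $p\in[0,1]$ of being verified by the supervisor satisfies $$p>\frac{(-f'(\varepsilon))\,k}{c}.$$ Then workers minimize their loss by playing a truthful strategy: any variance $v^*>0$ minimizing the worker's expected loss satisfies $v^*<\varepsilon$.
   Context: Quantitative model: workers report real-number evaluations of items. To produce an evaluation with variance $v>0$ (an unbiased measurement of the item's true value), a worker pays effort $f(v)$ per task, where the effort function $f:(0,\infty)\to[0,\infty)$ is monotonically decreasing, strictly convex and differentiable. A worker's strategy is the choice of a variance $v>0$, used on all its tasks; it is truthful if $v<\varepsilon$. One-level supervision: with probability $p$ a worker is verified by the supervisor, who evaluates one of the worker's tasks precisely (without error) and, if the worker's estimate is $x$ and the supervisor's is $y$, imposes the penalty $\ell(x,y)=c(x-y)^2$. Thus the worker's expected loss is $L(v)=k f(v)+p\,c\,v$. *)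

theory Defs
  imports "HOL-Probability.Probability"
begin

definition strictly_convex_on :: "real set \<Rightarrow> (real \<Rightarrow> real) \<Rightarrow> bool" where
  "strictly_convex_on A f \<longleftrightarrow>
     convex A \<and>
     (\<forall>x\<in>A. \<forall>y\<in>A. \<forall>t. x \<noteq> y \<longrightarrow> 0 < t \<longrightarrow> t < 1 \<longrightarrow>
        f ((1 - t) * x + t * y) < (1 - t) * f x + t * f y)"

text \<open>Effort functions live on the positive reals; their values elsewhere are irrelevant.
  Monotonicity is the weak one; together with strict convexity on the unbounded interval
  it already forces strict decrease.\<close>

definition effort_function :: "(real \<Rightarrow> real) \<Rightarrow> bool" where
  "effort_function f \<longleftrightarrow>
     (\<forall>v>0. 0 \<le> f v) \<and>
     antimono_on {0<..} f \<and>
     strictly_convex_on {0<..} f \<and>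
     f differentiable_on {0<..}"

text \<open>The distribution \<open>M\<close> of an evaluation of an item with true value \<open>y\<close>,
  unbiased and with variance \<open>v\<close>. Square integrability makes both moments genuine
  (the Bochner integral is \<open>0\<close> on non-integrable functions).\<close>

definition unbiased_evaluation :: "real measure \<Rightarrow> real \<Rightarrow> real \<Rightarrow> bool" where
  "unbiased_evaluation M y v \<longleftrightarrow>
     prob_space M \<and> sets M = sets borel \<and>
     integrable M (\<lambda>x. x\<^sup>2) \<and>
     prob_space.expectation M (\<lambda>x. x) = y \<and>
     prob_space.variance M (\<lambda>x. x) = v"

definition quadratic_loss :: "real \<Rightarrow> real \<Rightarrow> real \<Rightarrow> real" where
  "quadratic_loss c x y = c * (x - y)\<^sup>2"

text \<open>A worker has tasks \<open>0, \<dots>, k - 1\<close> with true values \<open>y j\<close>; its evaluation of task \<open>j\<close>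
  produced with variance \<open>v\<close> has distribution \<open>D v j\<close>. With probability \<open>p\<close> the worker is
  verified: the supervisor draws one task from \<open>S\<close>, independently of the evaluations, and
  evaluates it without error, i.e. as \<open>y j\<close>.\<close>

definition expected_loss ::
  "(real \<Rightarrow> real) \<Rightarrow> nat \<Rightarrow> real \<Rightarrow> real \<Rightarrow> nat pmf \<Rightarrow> (nat \<Rightarrow> real)
     \<Rightarrow> (real \<Rightarrow> nat \<Rightarrow> real measure) \<Rightarrow> real \<Rightarrow> real" where
  "expected_loss f k p c S y D v =
     real k * f v +
     p * measure_pmf.expectation S
           (\<lambda>j. prob_space.expectation (D v j) (\<lambda>x. quadratic_loss c x (y j)))"

lemma expected_quadratic_loss:
  assumes "unbiased_evaluation M y v"
  shows "prob_space.expectation M (\<lambda>x. quadratic_loss c x y) = c * v"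
  using assms by (auto simp: unbiased_evaluation_def quadratic_loss_def)

text \<open>Neither the true values, nor the shape of the evaluation distributions, nor the
  choice of the supervised task matters.\<close>

lemma expected_loss_eq:
  assumes "set_pmf S \<subseteq> {..<k}"
    and "\<And>j. j < k \<Longrightarrow> unbiased_evaluation (D v j) (y j) v"
  shows "expected_loss f k p c S y D v = real k * f v + p * c * v"
proof -
  have "measure_pmf.expectation S
          (\<lambda>j. prob_space.expectation (D v j) (\<lambda>x. quadratic_loss c x (y j)))
        = measure_pmf.expectation S (\<lambda>_. c * v)"
    using assms
    by (intro integral_cong_AE) (auto simp: AE_measure_pmf_iff expected_quadratic_loss)
  then show ?thesis
    by (simp add: expected_loss_def)
qed

definition truthful :: "real \<Rightarrow> real \<Rightarrow> bool" where
  "truthful \<epsilon> v \<longleftrightarrow> v < \<epsilon>"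

end

theory Submission
  imports Defs
begin

text \<open>The hypothesis on \<open>p\<close> says that the convex function \<open>L v = k f v + p c v\<close> has positive slope
  at \<open>\<epsilon>\<close>. So \<open>L\<close> lies above \<open>L \<epsilon>\<close> on \<open>{\<epsilon>..}\<close>, by its tangent there, while it takes
  smaller values just to the left of \<open>\<epsilon>\<close>.\<close>

text \<open>The criterion \<open>convex_on_linorderI\<close> asks only for \<open>x < y\<close> and
  \<open>0 < t < 1\<close>, which is where the strict inequality is available.\<close>

lemma strictly_convex_on_imp_convex_on:
  assumes "strictly_convex_on A f"
  shows "convex_on A f"
proof (rule convex_on_linorderI)
  show "convex A"
    using assms by (simp add: strictly_convex_on_def)
next
  fix t x y :: real
  assume "0 < t" "t < 1" "x \<in> A" "y \<in> A" "x < y"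
  then show "f ((1 - t) *\<^sub>R x + t *\<^sub>R y) \<le> (1 - t) * f x + t * f y"
    using assms by (auto simp: strictly_convex_on_def intro!: less_imp_le)
qed

text \<open>Interiority of \<open>a\<close> supplies points of \<open>A\<close> to its left; a left
  endpoint of \<open>A\<close> could itself be the minimizer.\<close>

lemma convex_on_arg_min_less:
  fixes g :: "real \<Rightarrow> real"
  assumes "convex_on A g" and "a \<in> interior A"
    and deriv: "(g has_real_derivative d) (at a)" and "0 < d"
    and min: "is_arg_min g (\<lambda>x. x \<in> A) m"
  shows "m < a"
proof (rule ccontr)
  assume "\<not> m < a"
  have m: "m \<in> A" "\<And>x. x \<in> A \<Longrightarrow> g m \<le> g x"
    using min by (auto simp: is_arg_min_def not_less)
  have "convex A"
    using assms(1) by (rule convex_on_imp_convex)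
  then have "d * (m - a) \<le> g m - g a"
    using assms m(1)
    by (intro convex_on_imp_above_tangent) (auto simp: convex_connected has_field_derivative_at_within)
  with \<open>\<not> m < a\<close> \<open>0 < d\<close> have "g a \<le> g m"
    by (smt (verit) mult_nonneg_nonneg)
  obtain e where e: "0 < e" "ball a e \<subseteq> A"
    using \<open>a \<in> interior A\<close> by (auto simp: mem_interior)
  obtain r where r: "0 < r" "\<And>h. 0 < h \<Longrightarrow> h < r \<Longrightarrow> g (a - h) < g a"
    using DERIV_pos_inc_left[OF deriv \<open>0 < d\<close>] by auto
  \<comment> \<open>Halving makes \<open>h\<close> strictly smaller than both radii, so
    \<open>a - h\<close> stays in \<open>A\<close> and lies where \<open>g\<close> is below
    \<open>g a\<close>.\<close>
  define h where "h = min e r / 2"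
  have h: "0 < h" "h < e" "h < r"
    using e(1) r(1) by (auto simp: h_def min_def)
  then have "a - h \<in> A"
    using e(2) by (auto simp: dist_real_def subset_iff)
  then show False
    using m(2)[of "a - h"] r(2)[OF h(1,3)] \<open>g a \<le> g m\<close> by simp
qed

theorem theorem2:
  fixes \<epsilon> c p :: real and k :: nat and f :: "real \<Rightarrow> real"
    and S :: "nat pmf" and y :: "nat \<Rightarrow> real"
    and D :: "real \<Rightarrow> nat \<Rightarrow> real measure" and v_opt :: real
  assumes "\<epsilon> > 0" and "k \<ge> 1" and "c > 0"
    and "effort_function f"
    and "set_pmf S \<subseteq> {..<k}"
    and "\<And>v j. v > 0 \<Longrightarrow> j < k \<Longrightarrow> unbiased_evaluation (D v j) (y j) v"
    and "0 \<le> p" and "p \<le> 1"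
    and "p > (- deriv f \<epsilon>) * real k / c"
    and "is_arg_min (expected_loss f k p c S y D) (\<lambda>v. v > 0) v_opt"
  shows "truthful \<epsilon> v_opt"
proof -
  \<comment> \<open>\<open>L\<close> is free of \<open>S\<close>, \<open>y\<close> and
    \<open>D\<close>. It is identified with the expected loss only for positive \<open>v\<close>,
    where \<open>D v\<close> is known to be unbiased with variance \<open>v\<close>.\<close>
  define L where "L v = real k * f v + p * c * v" for v
  have L: "expected_loss f k p c S y D v = L v" if "v > 0" for v
    using that assms(5,6) by (simp add: L_def expected_loss_eq)
  have "f differentiable_on {0<..}" and sconv: "strictly_convex_on {0<..} f"
    using \<open>effort_function f\<close> by (simp_all add: effort_function_def)
  \<comment> \<open>\<open>deriv\<close> is a choice operator, so differentiability is what makes it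
    the true derivative; on an open set, \<open>at \<epsilon> within\<close> is just
    \<open>at \<epsilon>\<close>.\<close>
  then have "(f has_real_derivative deriv f \<epsilon>) (at \<epsilon>)"
    using \<open>\<epsilon> > 0\<close>
    by (auto simp: differentiable_on_def at_within_open[of _ "{0<..}"]
        real_differentiable_def dest: DERIV_imp_deriv)
  then have deriv: "(L has_real_derivative real k * deriv f \<epsilon> + p * c) (at \<epsilon>)"
    unfolding L_def by (auto intro!: derivative_eq_intros)
  have "0 < real k * deriv f \<epsilon> + p * c"
    using assms(3,9) by (simp add: field_simps)
  moreover have "convex_on {0<..} L"
    unfolding L_def
    using \<open>c > 0\<close> \<open>0 \<le> p\<close> strictly_convex_on_imp_convex_on[OF sconv]
    by (intro convex_on_add convex_on_cmul) (auto simp: convex_on_ident)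
  moreover have "\<epsilon> \<in> interior {0<..}"
    using \<open>\<epsilon> > 0\<close> by (simp add: interior_open)
  \<comment> \<open>Minimality compares values at positive variances only, and there both functions
    agree.\<close>
  moreover have "is_arg_min L (\<lambda>v. v \<in> {0<..}) v_opt"
    using assms(10) by (auto simp: is_arg_min_def L)
  ultimately show ?thesis
    using convex_on_arg_min_less deriv by (auto simp: truthful_def)
qed

end
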